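(* Let $G$ be a graph and let $g=(\emptyset\to G\leftarrow\emptyset)$ be the corresponding morphism $\emptyset\to\emptyset$ of $\mathsf{Cospan}(\mathsf{UGraph})_{*}$. Then $$\mathrm{pw}(G)=\mathrm{mpwd}(g).$$
   Context: A graph $G=(V,E,\mathrm{ends})$ consists of finite sets $V$ (vertices), $E$ (edges) and a function $\mathrm{ends}:E\to\{S\subseteq V: |S|\in\{1,2\}\}$. Path width. A path decomposition of $G$ is a pair $(P,p)$ where $P$ is a path graph and $p:\mathrm{vertices}(P)\to\mathcal P(V)$ satisfies: (1) $\bigcup_i p(i)=V$; (2) for every $e\in E$ there is $i$ with $\mathrm{ends}(e)\subseteq p(i)$; (3) whenever $j$ lies between $i$ and $k$ on $P$, $p(i)\cap p(k)\subseteq p(j)$. Its width is $\max_i|p(i)|$ (no $1$ is subtracted), and $\mathrm{pw}(G)$ is the minimum width of a path decomposition of $G$. The category. $\mathsf{UGraph}$ has graphs as objects; a morphism $\alpha:G\to H$ is a pair of functions $\alpha_V$ (on vertices), $\alpha_E$ (on edges) with $\mathrm{ends}_H(\alpha_E(e))=\alpha_V(\mathrm{ends}_G(e))$. $\mathsf{Cospan}(\mathsf{UGraph})_{*}$ is the symmetric monoidal category whose objects are finite sets (regarded as discrete graphs) and whose morphisms $X\to Y$ are isomorphism classes of cospans $X\to G\leftarrow Y$ of graphs, i.e. a graph $G=(V,E)$ with functions $\partial_X:X\to V$, $\partial_Y:Y\to V$. Composition, written in diagrammatic order as $f\,;\,f'$ (or $f\,;_C f'$ when along $C$), is by pushout.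 Monoidal path width. Let $\mathcal A$ be the set of all morphisms (the atomic morphisms). The weight function $\nu$ is: $\nu(g)=|V|$ for a morphism $g=(X\to G\leftarrow Y)$ with $G=(V,E)$; $\nu(X)=|X|$ for composition along an object $X$. The set $D^{p}_f$ of monoidal path decompositions of $f:A\to B$ is defined recursively: $(f)\in D^{p}_f$ if $f\in\mathcal A$; $(d_1,;_C,d_2)\in D^{p}_f$ if $d_1\in D^{p}_{f_1}$, $d_2\in D^{p}_{f_2}$ with $f_1:A\to C$, $f_2:C\to B$ and $f=f_1\,;f_2$. Width: $\mathrm{wd}((f))=\nu(f)$; $\mathrm{wd}(d_1,;_C,d_2)=\max\{\mathrm{wd}(d_1),\nu(C),\mathrm{wd}(d_2)\}$. Then $\mathrm{mpwd}(f)=\min_{d\in D^{p}_f}\mathrm{wd}(d)$. *)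

theory Defs
  imports "HOL-Library.FuncSet" "HOL-Library.Infinite_Typeclass"
begin

section \<open>Graphs\<close>

record ('v, 'e) pre_ugraph =
  verts :: "'v set"
  edges :: "'e set"
  ends :: "'e \<Rightarrow> 'v set"

definition ugraph :: "('v, 'e) pre_ugraph \<Rightarrow> bool" where
  "ugraph G \<longleftrightarrow> finite (verts G) \<and> finite (edges G) \<and>
     (\<forall>e \<in> edges G. ends G e \<subseteq> verts G \<and> card (ends G e) \<in> {1, 2})"

definition ugraph_hom ::
  "('v, 'e) pre_ugraph \<Rightarrow> ('w, 'f) pre_ugraph \<Rightarrow> ('v \<Rightarrow> 'w) \<Rightarrow> ('e \<Rightarrow> 'f) \<Rightarrow> bool" where
  "ugraph_hom G H \<alpha>V \<alpha>E \<longleftrightarrow>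
     \<alpha>V \<in> verts G \<rightarrow> verts H \<and> \<alpha>E \<in> edges G \<rightarrow> edges H \<and>
     (\<forall>e \<in> edges G. ends H (\<alpha>E e) = \<alpha>V ` ends G e)"

definition ugraph_iso ::
  "('v, 'e) pre_ugraph \<Rightarrow> ('w, 'f) pre_ugraph \<Rightarrow> ('v \<Rightarrow> 'w) \<Rightarrow> ('e \<Rightarrow> 'f) \<Rightarrow> bool" where
  "ugraph_iso G H \<alpha>V \<alpha>E \<longleftrightarrow>
     ugraph_hom G H \<alpha>V \<alpha>E \<and>
     bij_betw \<alpha>V (verts G) (verts H) \<and> bij_betw \<alpha>E (edges G) (edges H)"


section \<open>Path width\<close>

text \<open>
  The path graph with \<open>n \<ge> 1\<close> vertices has vertex set \<open>{..<n}\<close>, consecutive numbers being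
  adjacent; so \<open>j\<close> lies between \<open>i\<close> and \<open>k\<close> iff \<open>i \<le> j \<le> k\<close> or \<open>k \<le> j \<le> i\<close>.
\<close>

definition path_decomposition :: "('v, 'e) pre_ugraph \<Rightarrow> nat \<Rightarrow> (nat \<Rightarrow> 'v set) \<Rightarrow> bool" where
  "path_decomposition G n p \<longleftrightarrow>
     1 \<le> n \<and>
     (\<Union>i<n. p i) = verts G \<and>
     (\<forall>e \<in> edges G. \<exists>i<n. ends G e \<subseteq> p i) \<and>
     (\<forall>i<n. \<forall>j<n. \<forall>k<n. (i \<le> j \<and> j \<le> k) \<or> (k \<le> j \<and> j \<le> i) \<longrightarrow> p i \<inter> p k \<subseteq> p j)"

definition path_decomposition_width :: "nat \<Rightarrow> (nat \<Rightarrow> 'v set) \<Rightarrow> nat" where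
  "path_decomposition_width n p = (MAX i\<in>{..<n}. card (p i))"

definition path_width :: "('v, 'e) pre_ugraph \<Rightarrow> nat" where
  "path_width G =
     (LEAST w. \<exists>n p. path_decomposition G n p \<and> w = path_decomposition_width n p)"


section \<open>Cospans of graphs between finite sets\<close>

text \<open>
  A graph morphism out of a discrete graph is just a function on vertices. The values of the
  legs outside \<open>src\<close> and \<open>tgt\<close>, like those of \<open>ends\<close> outside \<open>edges\<close>, are irrelevant: isomorphism
  of cospans does not see them.
\<close>

record ('a, 'v, 'e) pre_cospan =
  src :: "'a set"
  tgt :: "'a set"
  apex :: "('v, 'e) pre_ugraph"
  lleg :: "'a \<Rightarrow> 'v"
  rleg :: "'a \<Rightarrow> 'v"

definition cospan :: "('a, 'v, 'e) pre_cospan \<Rightarrow> bool" where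
  "cospan K \<longleftrightarrow> finite (src K) \<and> finite (tgt K) \<and> ugraph (apex K) \<and>
     lleg K \<in> src K \<rightarrow> verts (apex K) \<and> rleg K \<in> tgt K \<rightarrow> verts (apex K)"

definition cospan_iso :: "('a, 'v, 'e) pre_cospan \<Rightarrow> ('a, 'w, 'f) pre_cospan \<Rightarrow> bool" where
  "cospan_iso K L \<longleftrightarrow> src K = src L \<and> tgt K = tgt L \<and>
     (\<exists>\<alpha>V \<alpha>E. ugraph_iso (apex K) (apex L) \<alpha>V \<alpha>E \<and>
        (\<forall>x \<in> src K. \<alpha>V (lleg K x) = lleg L x) \<and>
        (\<forall>y \<in> tgt K. \<alpha>V (rleg K y) = rleg L y))"

text \<open>
  Gluing of \<open>K : X \<rightarrow> C\<close> and \<open>L : C \<rightarrow> Y\<close> along \<open>C = tgt K = src L\<close>: the vertices are those of the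
  disjoint union modulo the equivalence generated by \<open>rleg K c \<sim> lleg L c\<close>. There is no
  identification of edges, since \<open>C\<close> is discrete.
\<close>

definition glue_rel ::
  "('a, 'v, 'e) pre_cospan \<Rightarrow> ('a, 'w, 'f) pre_cospan \<Rightarrow> ('v + 'w) rel" where
  "glue_rel K L =
     (let R = {(Inl (rleg K c), Inr (lleg L c)) | c. c \<in> tgt K} in (R \<union> R\<inverse>)\<^sup>*)"

abbreviation glue_inl ::
  "('a, 'v, 'e) pre_cospan \<Rightarrow> ('a, 'w, 'f) pre_cospan \<Rightarrow> 'v \<Rightarrow> ('v + 'w) set" where
  "glue_inl K L v \<equiv> glue_rel K L `` {Inl v}"

abbreviation glue_inr ::
  "('a, 'v, 'e) pre_cospan \<Rightarrow> ('a, 'w, 'f) pre_cospan \<Rightarrow> 'w \<Rightarrow> ('v + 'w) set" where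
  "glue_inr K L w \<equiv> glue_rel K L `` {Inr w}"

definition glue_graph ::
  "('a, 'v, 'e) pre_cospan \<Rightarrow> ('a, 'w, 'f) pre_cospan \<Rightarrow> (('v + 'w) set, 'e + 'f) pre_ugraph" where
  "glue_graph K L =
     \<lparr>verts = (verts (apex K) <+> verts (apex L)) // glue_rel K L,
      edges = edges (apex K) <+> edges (apex L),
      ends = case_sum (\<lambda>e. glue_inl K L ` ends (apex K) e) (\<lambda>e. glue_inr K L ` ends (apex L) e)\<rparr>"

definition glue ::
  "('a, 'v, 'e) pre_cospan \<Rightarrow> ('a, 'w, 'f) pre_cospan \<Rightarrow> ('a, ('v + 'w) set, 'e + 'f) pre_cospan" where
  "glue K L =
     \<lparr>src = src K, tgt = tgt L, apex = glue_graph K L,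
      lleg = \<lambda>x. glue_inl K L (lleg K x), rleg = \<lambda>y. glue_inr K L (rleg L y)\<rparr>"

lemma glue_rel_generator:
  assumes "c \<in> tgt K"
  shows "(Inl (rleg K c), Inr (lleg L c)) \<in> glue_rel K L"
  using assms unfolding glue_rel_def Let_def by blast

lemma equiv_glue_rel: "equiv UNIV (glue_rel K L)"
  unfolding glue_rel_def Let_def
  by (intro equivI) (auto simp: refl_rtrancl trans_rtrancl intro!: sym_rtrancl sym_Un_converse)

lemma glue_rel_invariant:
  assumes "(x, y) \<in> glue_rel K L"
    and "\<And>c. c \<in> tgt K \<Longrightarrow> h (Inl (rleg K c)) = h (Inr (lleg L c))"
  shows "h x = h y"
  using assms(1) unfolding glue_rel_def Let_def
  by (induction rule: rtrancl_induct) (auto simp: assms(2))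

text \<open>The gluing is the pushout: it is a cocone, and it is universal among the cocones.\<close>

lemma glue_cocone:
  shows "ugraph_hom (apex K) (glue_graph K L) (glue_inl K L) Inl"
    and "ugraph_hom (apex L) (glue_graph K L) (glue_inr K L) Inr"
    and "c \<in> tgt K \<Longrightarrow> glue_inl K L (rleg K c) = glue_inr K L (lleg L c)"
proof -
  show "ugraph_hom (apex K) (glue_graph K L) (glue_inl K L) Inl"
    and "ugraph_hom (apex L) (glue_graph K L) (glue_inr K L) Inr"
    by (auto simp: ugraph_hom_def glue_graph_def intro: quotientI)
  show "glue_inl K L (rleg K c) = glue_inr K L (lleg L c)" if "c \<in> tgt K"
    using that by (rule equiv_class_eq[OF equiv_glue_rel glue_rel_generator])
qed

lemma cospan_glue:
  assumes K: "cospan K" and L: "cospan L" and KL: "tgt K = src L"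
  shows "cospan (glue K L)"
proof -
  have card_im: "card (h ` S) \<in> {1, 2}" if "card S \<in> {1, 2}" for h :: "'x \<Rightarrow> 'y" and S
  proof -
    from that have fin: "finite S" and ne: "S \<noteq> {}" by (auto intro: card_ge_0_finite)
    then have "card (h ` S) \<noteq> 0" by simp
    moreover have "card (h ` S) \<le> card S" by (rule card_image_le[OF fin])
    ultimately show ?thesis using that by auto
  qed
  have vim: "verts (glue_graph K L) = (\<lambda>x. glue_rel K L `` {x}) ` (verts (apex K) <+> verts (apex L))"
    by (auto simp: glue_graph_def quotient_def)
  have "finite (verts (glue_graph K L))"
    unfolding vim using K L by (auto simp: cospan_def ugraph_def)
  moreover have "ends (glue_graph K L) e \<subseteq> verts (glue_graph K L) \<and> card (ends (glue_graph K L) e) \<in> {1, 2}"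
    if e: "e \<in> edges (glue_graph K L)" for e
  proof (cases e)
    case (Inl a)
    then have "a \<in> edges (apex K)" using e by (auto simp: glue_graph_def)
    then have "ends (apex K) a \<subseteq> verts (apex K)" "card (ends (apex K) a) \<in> {1, 2}"
      using K unfolding cospan_def ugraph_def by blast+
    then show ?thesis using card_im[of "ends (apex K) a" "glue_inl K L"] Inl
      by (auto simp: glue_graph_def intro: quotientI simp del: insert_iff)
  next
    case (Inr b)
    then have "b \<in> edges (apex L)" using e by (auto simp: glue_graph_def)
    then have "ends (apex L) b \<subseteq> verts (apex L)" "card (ends (apex L) b) \<in> {1, 2}"
      using L unfolding cospan_def ugraph_def by blast+
    then show ?thesis using card_im[of "ends (apex L) b" "glue_inr K L"] Inr
      by (auto simp: glue_graph_def intro: quotientI simp del: insert_iff)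
  qed
  moreover have "finite (edges (glue_graph K L))"
    using K L by (auto simp: glue_graph_def cospan_def ugraph_def)
  ultimately show ?thesis
    using K L unfolding glue_def cospan_def ugraph_def
    by (auto simp: vim intro!: imageI)
qed

lemma glue_universal:
  assumes K: "cospan K" and L: "cospan L"
    and f: "ugraph_hom (apex K) H \<alpha>V \<alpha>E" and g: "ugraph_hom (apex L) H \<beta>V \<beta>E"
    and comm: "\<And>c. c \<in> tgt K \<Longrightarrow> \<alpha>V (rleg K c) = \<beta>V (lleg L c)"
  shows "\<exists>\<gamma>V \<gamma>E. ugraph_hom (glue_graph K L) H \<gamma>V \<gamma>E \<and>
           (\<forall>v \<in> verts (apex K). \<gamma>V (glue_inl K L v) = \<alpha>V v) \<and>
           (\<forall>v \<in> verts (apex L). \<gamma>V (glue_inr K L v) = \<beta>V v) \<and>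
           (\<forall>e \<in> edges (apex K). \<gamma>E (Inl e) = \<alpha>E e) \<and>
           (\<forall>e \<in> edges (apex L). \<gamma>E (Inr e) = \<beta>E e)"
    and "\<lbrakk>\<And>v. v \<in> verts (apex K) \<Longrightarrow> \<gamma> (glue_inl K L v) = \<gamma>' (glue_inl K L v);
          \<And>v. v \<in> verts (apex L) \<Longrightarrow> \<gamma> (glue_inr K L v) = \<gamma>' (glue_inr K L v);
          x \<in> verts (glue_graph K L)\<rbrakk> \<Longrightarrow> \<gamma> x = \<gamma>' x"
proof -
  define h where "h = case_sum \<alpha>V \<beta>V"
  define \<gamma>V where "\<gamma>V X = h (SOME x. x \<in> X)" for X
  have h: "h x = h y" if "(x, y) \<in> glue_rel K L" for x y
    using that by (rule glue_rel_invariant) (simp add: h_def comm)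
  have \<gamma>V: "\<gamma>V (glue_rel K L `` {x}) = h x" for x
  proof -
    have "x \<in> glue_rel K L `` {x}"
      by (rule equiv_class_self[OF equiv_glue_rel]) simp
    then have "(SOME y. y \<in> glue_rel K L `` {x}) \<in> glue_rel K L `` {x}" by (rule someI)
    then show ?thesis unfolding \<gamma>V_def using h by force
  qed
  have endsK: "ends (apex K) e \<subseteq> verts (apex K)" if "e \<in> edges (apex K)" for e
    using K that by (auto simp: cospan_def ugraph_def)
  have endsL: "ends (apex L) e \<subseteq> verts (apex L)" if "e \<in> edges (apex L)" for e
    using L that by (auto simp: cospan_def ugraph_def)
  have "ugraph_hom (glue_graph K L) H \<gamma>V (case_sum \<alpha>E \<beta>E)"
    using f g endsK endsL
    by (auto simp: ugraph_hom_def glue_graph_def quotient_def \<gamma>V h_def image_image Pi_iff)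
  then show "\<exists>\<gamma>V \<gamma>E. ugraph_hom (glue_graph K L) H \<gamma>V \<gamma>E \<and>
           (\<forall>v \<in> verts (apex K). \<gamma>V (glue_inl K L v) = \<alpha>V v) \<and>
           (\<forall>v \<in> verts (apex L). \<gamma>V (glue_inr K L v) = \<beta>V v) \<and>
           (\<forall>e \<in> edges (apex K). \<gamma>E (Inl e) = \<alpha>E e) \<and>
           (\<forall>e \<in> edges (apex L). \<gamma>E (Inr e) = \<beta>E e)"
    by (intro exI[of _ \<gamma>V] exI[of _ "case_sum \<alpha>E \<beta>E"]) (simp add: \<gamma>V h_def)
  show "\<gamma> x = \<gamma>' x"
    if "\<And>v. v \<in> verts (apex K) \<Longrightarrow> \<gamma> (glue_inl K L v) = \<gamma>' (glue_inl K L v)"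
       "\<And>v. v \<in> verts (apex L) \<Longrightarrow> \<gamma> (glue_inr K L v) = \<gamma>' (glue_inr K L v)"
       "x \<in> verts (glue_graph K L)"
    using that by (auto simp: glue_graph_def quotient_def)
qed


section \<open>Morphisms\<close>

text \<open>
  Objects are the finite sets over an arbitrary infinite type \<open>'u\<close>, and the vertices and edges of
  apexes are drawn from \<open>'u\<close> as well. Since \<open>'u\<close> is infinite, every cospan of finite graphs, over
  whatever types (in particular every \<^const>\<open>glue\<close>), has an isomorphic copy there, and a morphism is the
  set of all copies.
\<close>

type_synonym 'u morphism = "('u, 'u, 'u) pre_cospan set"

definition iso_class :: "('u, 'v, 'e) pre_cospan \<Rightarrow> 'u morphism" where
  "iso_class K = {L. cospan L \<and> cospan_iso K L}"

definition hom :: "'u set \<Rightarrow> 'u set \<Rightarrow> 'u morphism set" where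
  "hom X Y = {iso_class K | K :: ('u, 'u, 'u) pre_cospan. cospan K \<and> src K = X \<and> tgt K = Y}"

text \<open>All choices of representatives contribute the same isomorphism class to the union.\<close>

definition seq_compose :: "'u morphism \<Rightarrow> 'u morphism \<Rightarrow> 'u morphism" where
  "seq_compose f g = (\<Union>K \<in> f. \<Union>L \<in> g. iso_class (glue K L))"

definition graph_morphism :: "('v, 'e) pre_ugraph \<Rightarrow> 'u morphism" where
  "graph_morphism G =
     iso_class \<lparr>src = {}, tgt = {}, apex = G, lleg = \<lambda>_. undefined, rleg = \<lambda>_. undefined\<rparr>"


section \<open>Monoidal path width\<close>

definition atomic :: "'u morphism set" where
  "atomic = (\<Union>X Y. hom X Y)"

text \<open>The number of vertices is the same for all representatives of a morphism.\<close>

definition morphism_weight :: "'u morphism \<Rightarrow> nat" where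
  "morphism_weight f = the_elem ((\<lambda>K. card (verts (apex K))) ` f)"

definition object_weight :: "'u set \<Rightarrow> nat" where
  "object_weight X = card X"

datatype 'u decomp = Atom "'u morphism" | Comp "'u decomp" "'u set" "'u decomp"

inductive monoidal_path_decomp :: "'u morphism \<Rightarrow> 'u decomp \<Rightarrow> bool" where
  atom: "f \<in> atomic \<Longrightarrow> monoidal_path_decomp f (Atom f)"
| comp: "\<lbrakk>f1 \<in> hom A C; f2 \<in> hom C B; monoidal_path_decomp f1 d1; monoidal_path_decomp f2 d2\<rbrakk>
    \<Longrightarrow> monoidal_path_decomp (seq_compose f1 f2) (Comp d1 C d2)"

primrec decomp_width :: "'u decomp \<Rightarrow> nat" where
  "decomp_width (Atom f) = morphism_weight f"
| "decomp_width (Comp d1 C d2) =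
     max (decomp_width d1) (max (object_weight C) (decomp_width d2))"

definition monoidal_path_width :: "'u morphism \<Rightarrow> nat" where
  "monoidal_path_width f = (LEAST w. \<exists>d. monoidal_path_decomp f d \<and> w = decomp_width d)"

end

theory Submission
  imports Defs
begin

text \<open>
  A monoidal decomposition is turned into a path decomposition by listing the images of the apexes
  of its atoms from left to right; the induction carries along that the left leg lands in the first
  bag and the right leg in the last one. Conversely, a path decomposition slices the graph into
  atoms: the \<open>k\<close>-th atom has the \<open>k\<close>-th bag as vertices, the edges that fit into that bag but into
  no earlier one, and is glued to the preceding part along the intersection of the bags \<open>k - 1\<close>
  and \<open>k\<close>.
\<close>

section \<open>Isomorphisms of cospans\<close>

text \<open>\<open>inv_into\<close> undoes \<alpha>V only on vertices of \<open>G\<close>, so the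
  ends of edges must be known to be vertices; this is what \<open>ugraph G\<close> supplies.\<close>

lemma ugraph_iso_inverse:
  assumes "ugraph G" "ugraph_iso G H \<alpha>V \<alpha>E"
  shows "ugraph_iso H G (inv_into (verts G) \<alpha>V) (inv_into (edges G) \<alpha>E)"
proof -
  let ?\<beta>V = "inv_into (verts G) \<alpha>V" and ?\<beta>E = "inv_into (edges G) \<alpha>E"
  have V: "bij_betw \<alpha>V (verts G) (verts H)" and E: "bij_betw \<alpha>E (edges G) (edges H)"
    and hom: "\<And>e. e \<in> edges G \<Longrightarrow> ends H (\<alpha>E e) = \<alpha>V ` ends G e"
    using assms(2) by (auto simp: ugraph_iso_def ugraph_hom_def)
  have V': "bij_betw ?\<beta>V (verts H) (verts G)" and E': "bij_betw ?\<beta>E (edges H) (edges G)"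
    using V E by (auto intro: bij_betw_inv_into)
  have "ends G (?\<beta>E f) = ?\<beta>V ` ends H f" if f: "f \<in> edges H" for f
  proof -
    have e: "?\<beta>E f \<in> edges G" using E' f by (rule bij_betwE[THEN bspec])
    have "\<alpha>E (?\<beta>E f) = f" using E f by (rule bij_betw_inv_into_right)
    then have "ends H f = \<alpha>V ` ends G (?\<beta>E f)" using hom[OF e] by simp
    moreover have "ends G (?\<beta>E f) \<subseteq> verts G" using assms(1) e by (auto simp: ugraph_def)
    ultimately show ?thesis using V by (simp add: bij_betw_def inv_into_image_cancel)
  qed
  then show ?thesis
    using V' E' by (auto simp: ugraph_iso_def ugraph_hom_def dest: bij_betwE)
qed

lemma ugraph_iso_comp:
  assumes 1: "ugraph_iso G H \<alpha>V \<alpha>E" and 2: "ugraph_iso H J \<beta>V \<beta>E"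
  shows "ugraph_iso G J (\<beta>V \<circ> \<alpha>V) (\<beta>E \<circ> \<alpha>E)"
  using 1 2 unfolding ugraph_iso_def ugraph_hom_def
  by (auto intro: bij_betw_trans simp: Pi_iff image_comp)

lemma cospan_iso_refl: "cospan_iso K K"
  unfolding cospan_iso_def ugraph_iso_def ugraph_hom_def
  by (auto intro!: exI[of _ id] bij_betw_id simp del: id_apply) auto

lemma cospan_iso_sym:
  assumes K: "cospan K" and "cospan_iso K L"
  shows "cospan_iso L K"
proof -
  obtain \<alpha>V \<alpha>E where iso: "ugraph_iso (apex K) (apex L) \<alpha>V \<alpha>E"
    and l: "\<And>x. x \<in> src K \<Longrightarrow> \<alpha>V (lleg K x) = lleg L x"
    and r: "\<And>x. x \<in> tgt K \<Longrightarrow> \<alpha>V (rleg K x) = rleg L x"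
    and st: "src K = src L" "tgt K = tgt L"
    using assms(2) by (auto simp: cospan_iso_def)
  have V: "inj_on \<alpha>V (verts (apex K))" using iso by (auto simp: ugraph_iso_def bij_betw_def)
  have "inv_into (verts (apex K)) \<alpha>V (lleg L x) = lleg K x" if "x \<in> src K" for x
    using K V that by (auto simp: l[symmetric] cospan_def Pi_iff)
  moreover have "inv_into (verts (apex K)) \<alpha>V (rleg L x) = rleg K x" if "x \<in> tgt K" for x
    using K V that by (auto simp: r[symmetric] cospan_def Pi_iff)
  moreover have "ugraph (apex K)" using K by (simp add: cospan_def)
  ultimately show ?thesis
    using ugraph_iso_inverse[OF _ iso] st by (auto simp: cospan_iso_def)
qed

lemma cospan_iso_trans:
  assumes 1: "cospan_iso K L" and 2: "cospan_iso L M"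
  shows "cospan_iso K M"
proof -
  obtain \<alpha>V \<alpha>E where a: "ugraph_iso (apex K) (apex L) \<alpha>V \<alpha>E"
    "\<And>x. x \<in> src K \<Longrightarrow> \<alpha>V (lleg K x) = lleg L x"
    "\<And>x. x \<in> tgt K \<Longrightarrow> \<alpha>V (rleg K x) = rleg L x" "src K = src L" "tgt K = tgt L"
    using 1 by (auto simp: cospan_iso_def)
  obtain \<beta>V \<beta>E where b: "ugraph_iso (apex L) (apex M) \<beta>V \<beta>E"
    "\<And>x. x \<in> src L \<Longrightarrow> \<beta>V (lleg L x) = lleg M x"
    "\<And>x. x \<in> tgt L \<Longrightarrow> \<beta>V (rleg L x) = rleg M x" "src L = src M" "tgt L = tgt M"
    using 2 by (auto simp: cospan_iso_def)
  from ugraph_iso_comp[OF a(1) b(1)] show ?thesis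
    using a b unfolding cospan_iso_def
    by (intro conjI exI[of _ "\<beta>V \<circ> \<alpha>V"] exI[of _ "\<beta>E \<circ> \<alpha>E"]) auto
qed

lemma iso_class_self: "cospan K \<Longrightarrow> K \<in> iso_class K"
  by (simp add: iso_class_def cospan_iso_refl)

text \<open>\<open>K\<close> and \<open>L\<close> may have different vertex and edge types. Thus one
  morphism over \<open>'u\<close> can be named both by a glued cospan, whose vertices are
  equivalence classes, and by a cospan with vertices in \<open>'u\<close>.\<close>

lemma iso_class_eqI:
  assumes "cospan K" "cospan_iso K L"
  shows "iso_class K = (iso_class L :: 'u morphism)"
proof -
  have "cospan_iso K M \<longleftrightarrow> cospan_iso L M" for M :: "('u, 'u, 'u) pre_cospan"
    using cospan_iso_trans[OF assms(2)] cospan_iso_trans[OF cospan_iso_sym[OF assms]]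
    by blast
  then show ?thesis by (simp add: iso_class_def)
qed

lemma homD:
  fixes f :: "'u morphism"
  assumes "f \<in> hom X Y" "K \<in> f"
  shows "cospan K" "src K = X" "tgt K = Y" "iso_class K = f"
proof -
  obtain L :: "('u, 'u, 'u) pre_cospan"
    where L: "cospan L" "src L = X" "tgt L = Y" "f = iso_class L"
    using assms(1) unfolding hom_def by blast
  then have KL: "cospan K" "cospan_iso L K" using assms(2) by (auto simp: iso_class_def)
  then show "cospan K" "src K = X" "tgt K = Y" using L by (auto simp: cospan_iso_def)
  show "iso_class K = f" using iso_class_eqI[OF L(1) KL(2)] L(4) by simp
qed

lemma morphism_weight_iso_class:
  fixes K :: "('u, 'u, 'u) pre_cospan"
  assumes K: "cospan K"
  shows "morphism_weight (iso_class K) = card (verts (apex K))"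
proof -
  have "card (verts (apex L)) = card (verts (apex K))" if "L \<in> iso_class K" for L
    using that by (auto simp: iso_class_def cospan_iso_def ugraph_iso_def dest: bij_betw_same_card)
  then have "(\<lambda>L. card (verts (apex L))) ` iso_class K = (\<lambda>_. card (verts (apex K))) ` iso_class K"
    by (rule image_cong[OF refl])
  \<comment> \<open>\<open>the_elem\<close> requires exactly one value: the class is nonempty
    because it contains \<open>K\<close> itself.\<close>
  also have "\<dots> = {card (verts (apex K))}"
    using iso_class_self[OF K] by (rule image_constant)
  finally have "(\<lambda>L. card (verts (apex L))) ` iso_class K = {card (verts (apex K))}" .
  then show ?thesis by (simp add: morphism_weight_def)
qed


section \<open>Pushouts\<close>

lemma glue_rel_class_eq_iff: "glue_rel K L `` {x} = glue_rel K L `` {y} \<longleftrightarrow> (x, y) \<in> glue_rel K L"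
  using eq_equiv_class_iff[OF equiv_glue_rel] by blast

text \<open>Recognition principle for pushouts. The universal property yields a comparison map from
  the gluing to \<open>M\<close>; \<open>surj\<close> makes it onto on vertices, \<open>ker\<close>
  makes it injective there, and \<open>edges\<close> settles the edges, among which nothing is
  identified.\<close>

lemma cospan_iso_glueI:
  fixes K :: "('a, 'v, 'e) pre_cospan" and L :: "('a, 'w, 'f) pre_cospan"
  assumes K: "cospan K" and L: "cospan L"
    and f: "ugraph_hom (apex K) (apex M) \<alpha>V \<alpha>E" and g: "ugraph_hom (apex L) (apex M) \<beta>V \<beta>E"
    and comm: "\<And>c. c \<in> tgt K \<Longrightarrow> \<alpha>V (rleg K c) = \<beta>V (lleg L c)"
    and surj: "verts (apex M) \<subseteq> \<alpha>V ` verts (apex K) \<union> \<beta>V ` verts (apex L)"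
    and ker: "\<And>x y. \<lbrakk>x \<in> verts (apex K) <+> verts (apex L); y \<in> verts (apex K) <+> verts (apex L);
        case_sum \<alpha>V \<beta>V x = case_sum \<alpha>V \<beta>V y\<rbrakk> \<Longrightarrow> (x, y) \<in> glue_rel K L"
    and edges: "bij_betw (case_sum \<alpha>E \<beta>E) (edges (apex K) <+> edges (apex L)) (edges (apex M))"
    and src: "src M = src K" and tgt: "tgt M = tgt L"
    and lleg: "\<And>x. x \<in> src K \<Longrightarrow> \<alpha>V (lleg K x) = lleg M x"
    and rleg: "\<And>y. y \<in> tgt L \<Longrightarrow> \<beta>V (rleg L y) = rleg M y"
  shows "cospan_iso (glue K L) M"
proof -
  obtain \<gamma>V \<gamma>E where \<gamma>: "ugraph_hom (glue_graph K L) (apex M) \<gamma>V \<gamma>E"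
    "\<forall>v \<in> verts (apex K). \<gamma>V (glue_inl K L v) = \<alpha>V v"
    "\<forall>v \<in> verts (apex L). \<gamma>V (glue_inr K L v) = \<beta>V v"
    "\<forall>e \<in> edges (apex K). \<gamma>E (Inl e) = \<alpha>E e"
    "\<forall>e \<in> edges (apex L). \<gamma>E (Inr e) = \<beta>E e"
    using glue_universal(1)[OF K L f g comm] by blast
  have \<gamma>V: "\<gamma>V (glue_rel K L `` {x}) = case_sum \<alpha>V \<beta>V x"
    if "x \<in> verts (apex K) <+> verts (apex L)" for x
    using that \<gamma>(2,3) by auto
  have "inj_on \<gamma>V (verts (glue_graph K L))"
  proof (rule inj_onI)
    fix X Y assume XY: "X \<in> verts (glue_graph K L)" "Y \<in> verts (glue_graph K L)" "\<gamma>V X = \<gamma>V Y"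
    then obtain x y where xy: "x \<in> verts (apex K) <+> verts (apex L)" "X = glue_rel K L `` {x}"
      "y \<in> verts (apex K) <+> verts (apex L)" "Y = glue_rel K L `` {y}"
      by (auto simp: glue_graph_def elim!: quotientE)
    then have "(x, y) \<in> glue_rel K L" using XY(3) ker \<gamma>V by metis
    then show "X = Y" using xy by (simp add: glue_rel_class_eq_iff)
  qed
  moreover have "\<gamma>V ` verts (glue_graph K L) = verts (apex M)"
  proof
    show "\<gamma>V ` verts (glue_graph K L) \<subseteq> verts (apex M)" using \<gamma>(1) by (auto simp: ugraph_hom_def)
    show "verts (apex M) \<subseteq> \<gamma>V ` verts (glue_graph K L)"
    proof
      fix m assume "m \<in> verts (apex M)"
      then obtain x where x: "x \<in> verts (apex K) <+> verts (apex L)" "m = case_sum \<alpha>V \<beta>V x"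
        using surj by force
      then have "glue_rel K L `` {x} \<in> verts (glue_graph K L)"
        by (auto simp: glue_graph_def intro: quotientI)
      then show "m \<in> \<gamma>V ` verts (glue_graph K L)" using \<gamma>V x by (metis imageI)
    qed
  qed
  moreover have "bij_betw \<gamma>E (edges (glue_graph K L)) (edges (apex M)) \<longleftrightarrow>
      bij_betw (case_sum \<alpha>E \<beta>E) (edges (glue_graph K L)) (edges (apex M))"
    using \<gamma>(4,5) by (intro bij_betw_cong) (auto simp: glue_graph_def)
  then have "bij_betw \<gamma>E (edges (glue_graph K L)) (edges (apex M))"
    using edges by (simp add: glue_graph_def)
  ultimately have "ugraph_iso (glue_graph K L) (apex M) \<gamma>V \<gamma>E"
    using \<gamma>(1) by (simp add: ugraph_iso_def bij_betw_def)
  moreover have "\<gamma>V (glue_inl K L (lleg K x)) = lleg M x" if "x \<in> src K" for x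
    using that K \<gamma>(2) lleg by (auto simp: cospan_def Pi_iff)
  moreover have "\<gamma>V (glue_inr K L (rleg L x)) = rleg M x" if "x \<in> tgt L" for x
    using that L \<gamma>(3) rleg by (auto simp: cospan_def Pi_iff)
  ultimately show ?thesis
    using src tgt by (auto simp: cospan_iso_def glue_def)
qed

text \<open>Composition must not depend on the chosen copies. The given isomorphisms, followed by
  the class maps of \<open>glue K' L'\<close>, form a cocone to which
  \<open>cospan_iso_glueI\<close> applies.\<close>

lemma glue_cong:
  assumes K: "cospan K" and L: "cospan L" and KL: "tgt K = src L"
    and isoK: "cospan_iso K K'" and isoL: "cospan_iso L L'"
  shows "cospan_iso (glue K L) (glue K' L')"
proof -
  obtain \<alpha>V \<alpha>E where a: "ugraph_iso (apex K) (apex K') \<alpha>V \<alpha>E"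
    and al: "\<And>x. x \<in> src K \<Longrightarrow> \<alpha>V (lleg K x) = lleg K' x"
    and ar: "\<And>x. x \<in> tgt K \<Longrightarrow> \<alpha>V (rleg K x) = rleg K' x"
    and ast: "src K = src K'" "tgt K = tgt K'"
    using isoK by (auto simp: cospan_iso_def)
  obtain \<beta>V \<beta>E where b: "ugraph_iso (apex L) (apex L') \<beta>V \<beta>E"
    and bl: "\<And>x. x \<in> src L \<Longrightarrow> \<beta>V (lleg L x) = lleg L' x"
    and br: "\<And>x. x \<in> tgt L \<Longrightarrow> \<beta>V (rleg L x) = rleg L' x"
    and bst: "src L = src L'" "tgt L = tgt L'"
    using isoL by (auto simp: cospan_iso_def)
  have aV: "bij_betw \<alpha>V (verts (apex K)) (verts (apex K'))"
    and aE: "bij_betw \<alpha>E (edges (apex K)) (edges (apex K'))"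
    and bV: "bij_betw \<beta>V (verts (apex L)) (verts (apex L'))"
    and bE: "bij_betw \<beta>E (edges (apex L)) (edges (apex L'))"
    using a b by (auto simp: ugraph_iso_def)
  define \<alpha>' where "\<alpha>' = inv_into (verts (apex K)) \<alpha>V"
  define \<beta>' where "\<beta>' = inv_into (verts (apex L)) \<beta>V"
  have \<alpha>': "\<alpha>' (\<alpha>V v) = v" if "v \<in> verts (apex K)" for v
    using aV that by (simp add: \<alpha>'_def bij_betw_def)
  have \<beta>': "\<beta>' (\<beta>V v) = v" if "v \<in> verts (apex L)" for v
    using bV that by (simp add: \<beta>'_def bij_betw_def)
  \<comment> \<open>The map sending \<open>x\<close> to the class of
    \<open>map_sum \<alpha>' \<beta>' x\<close> under \<open>glue_rel K L\<close> agrees on the two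
    members of each generating pair of \<open>glue_rel K' L'\<close>, hence on all related
    pairs.\<close>
  have ker: "(map_sum \<alpha>' \<beta>' x, map_sum \<alpha>' \<beta>' y) \<in> glue_rel K L"
    if "(x, y) \<in> glue_rel K' L'" for x y
  proof -
    have "glue_rel K L `` {map_sum \<alpha>' \<beta>' x} = glue_rel K L `` {map_sum \<alpha>' \<beta>' y}"
    proof (rule glue_rel_invariant[OF that])
      fix c assume "c \<in> tgt K'"
      then have c: "c \<in> tgt K" "c \<in> src L" using ast KL by auto
      then have "\<alpha>' (rleg K' c) = rleg K c" "\<beta>' (lleg L' c) = lleg L c"
        using K L \<alpha>' \<beta>' by (auto simp: ar[symmetric] bl[symmetric] cospan_def Pi_iff)
      then show "glue_rel K L `` {map_sum \<alpha>' \<beta>' (Inl (rleg K' c))} =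
          glue_rel K L `` {map_sum \<alpha>' \<beta>' (Inr (lleg L' c))}"
        using glue_cocone(3)[OF c(1)] by simp
    qed
    then show ?thesis by (simp add: glue_rel_class_eq_iff)
  qed
  let ?R = "glue_rel K' L'"
  have vim: "verts (glue_graph K' L') =
      (\<lambda>x. ?R `` {x}) ` (verts (apex K') <+> verts (apex L'))"
    by (auto simp: glue_graph_def quotient_def)
  have map_back: "map_sum \<alpha>' \<beta>' (map_sum \<alpha>V \<beta>V x) = x"
    if "x \<in> verts (apex K) <+> verts (apex L)" for x
    using that \<alpha>' \<beta>' by auto
  have case_map: "case_sum (\<lambda>v. glue_inl K' L' (\<alpha>V v)) (\<lambda>v. glue_inr K' L' (\<beta>V v)) x
      = ?R `` {map_sum \<alpha>V \<beta>V x}" for x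
    by (cases x) auto
  show ?thesis
  proof (rule cospan_iso_glueI[OF K L, where \<alpha>V = "\<lambda>v. glue_inl K' L' (\<alpha>V v)"
        and \<beta>V = "\<lambda>v. glue_inr K' L' (\<beta>V v)" and \<alpha>E = "Inl \<circ> \<alpha>E" and \<beta>E = "Inr \<circ> \<beta>E"])
    show "ugraph_hom (apex K) (apex (glue K' L')) (\<lambda>v. glue_inl K' L' (\<alpha>V v)) (Inl \<circ> \<alpha>E)"
      using a by (auto simp: glue_def glue_graph_def ugraph_iso_def ugraph_hom_def intro: quotientI)
    show "ugraph_hom (apex L) (apex (glue K' L')) (\<lambda>v. glue_inr K' L' (\<beta>V v)) (Inr \<circ> \<beta>E)"
      using b by (auto simp: glue_def glue_graph_def ugraph_iso_def ugraph_hom_def intro: quotientI)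
    show "glue_inl K' L' (\<alpha>V (rleg K c)) = glue_inr K' L' (\<beta>V (lleg L c))" if "c \<in> tgt K" for c
      using that ast KL glue_cocone(3)[of c K' L'] by (simp add: ar bl)
    show "verts (apex (glue K' L')) \<subseteq> (\<lambda>v. glue_inl K' L' (\<alpha>V v)) ` verts (apex K) \<union>
        (\<lambda>v. glue_inr K' L' (\<beta>V v)) ` verts (apex L)"
      using bij_betw_imp_surj_on[OF aV, symmetric] bij_betw_imp_surj_on[OF bV, symmetric]
      by (auto simp: glue_def vim)
    show "(x, y) \<in> glue_rel K L"
      if "x \<in> verts (apex K) <+> verts (apex L)" "y \<in> verts (apex K) <+> verts (apex L)"
        "case_sum (\<lambda>v. glue_inl K' L' (\<alpha>V v)) (\<lambda>v. glue_inr K' L' (\<beta>V v)) x =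
         case_sum (\<lambda>v. glue_inl K' L' (\<alpha>V v)) (\<lambda>v. glue_inr K' L' (\<beta>V v)) y" for x y
    proof -
      have "(map_sum \<alpha>V \<beta>V x, map_sum \<alpha>V \<beta>V y) \<in> ?R"
        using that(3) unfolding case_map glue_rel_class_eq_iff .
      from ker[OF this] show ?thesis using that(1,2) by (simp add: map_back)
    qed
    show "bij_betw (case_sum (Inl \<circ> \<alpha>E) (Inr \<circ> \<beta>E)) (edges (apex K) <+> edges (apex L))
        (edges (apex (glue K' L')))"
      using bij_betw_imp_surj_on[OF aE, symmetric] bij_betw_imp_surj_on[OF bE, symmetric]
        bij_betw_imp_inj_on[OF aE] bij_betw_imp_inj_on[OF bE]
      by (intro bij_betw_imageI inj_onI) (auto simp: glue_def glue_graph_def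
          dest: inj_onD intro: rev_image_eqI[OF InlI] rev_image_eqI[OF InrI])
  qed (use ast bst in \<open>auto simp: glue_def al br\<close>)
qed

lemma seq_compose_iso_class:
  fixes K L :: "('u, 'u, 'u) pre_cospan"
  assumes K: "cospan K" and L: "cospan L" and KL: "tgt K = src L"
  shows "seq_compose (iso_class K) (iso_class L) = (iso_class (glue K L) :: 'u morphism)"
proof -
  have "(iso_class (glue K' L') :: 'u morphism) = iso_class (glue K L)"
    if "K' \<in> iso_class K" "L' \<in> iso_class L" for K' L'
  proof -
    have K': "cospan_iso K K'" and L': "cospan_iso L L'"
      using that by (auto simp: iso_class_def)
    then show ?thesis
      using iso_class_eqI[OF cospan_glue[OF K L KL] glue_cong[OF K L KL K' L']] by simp
  qed
  then have "seq_compose (iso_class K) (iso_class L) =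
      (\<Union>K'\<in>iso_class K. \<Union>L'\<in>iso_class L. iso_class (glue K L))"
    unfolding seq_compose_def by (intro SUP_cong refl) auto
  \<comment> \<open>Both index sets are nonempty, so the union of the constant family is that
    constant.\<close>
  then show ?thesis using iso_class_self[OF K] iso_class_self[OF L] by auto
qed

section \<open>Gluing subgraphs along inclusions\<close>

definition incl_cospan :: "'u set \<Rightarrow> 'u set \<Rightarrow> ('u, 'e) pre_ugraph \<Rightarrow> ('u, 'u, 'e) pre_cospan" where
  "incl_cospan X Y G = \<lparr>src = X, tgt = Y, apex = G, lleg = \<lambda>x. x, rleg = \<lambda>x. x\<rparr>"

lemma incl_cospan_simps [simp]:
  "src (incl_cospan X Y G) = X" "tgt (incl_cospan X Y G) = Y" "apex (incl_cospan X Y G) = G"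
  "lleg (incl_cospan X Y G) x = x" "rleg (incl_cospan X Y G) x = x"
  by (simp_all add: incl_cospan_def)

lemma cospan_incl_cospan:
  assumes "ugraph G" "X \<subseteq> verts G" "Y \<subseteq> verts G"
  shows "cospan (incl_cospan X Y G)"
  using assms by (auto simp: cospan_def ugraph_def intro: finite_subset)

text \<open>With inclusions as legs, exactly the two copies of each point of \<open>C\<close> are
  identified; taking \<open>C\<close> to be the whole intersection therefore gives the union. Gluing
  never merges edges, so \<open>E\<close> and \<open>F\<close> have to be disjoint.\<close>

lemma glue_incl_cospan:
  assumes G: "ugraph \<lparr>verts = V, edges = E, ends = d\<rparr>"
    and H: "ugraph \<lparr>verts = W, edges = F, ends = d\<rparr>"
    and XY: "X \<subseteq> V" "Y \<subseteq> W" and C: "V \<inter> W = C" and EF: "E \<inter> F = {}"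
  shows "cospan_iso
      (glue (incl_cospan X C \<lparr>verts = V, edges = E, ends = d\<rparr>)
            (incl_cospan C Y \<lparr>verts = W, edges = F, ends = d\<rparr>))
      (incl_cospan X Y \<lparr>verts = V \<union> W, edges = E \<union> F, ends = d\<rparr>)" (is "cospan_iso (glue ?K ?L) ?M")
proof (rule cospan_iso_glueI[where \<alpha>V = "\<lambda>x. x" and \<beta>V = "\<lambda>x. x" and \<alpha>E = "\<lambda>x. x" and \<beta>E = "\<lambda>x. x"])
  show "cospan ?K" "cospan ?L" using G H XY C by (auto intro!: cospan_incl_cospan)
  show "(x, y) \<in> glue_rel ?K ?L"
    if xy: "x \<in> verts (apex ?K) <+> verts (apex ?L)" "y \<in> verts (apex ?K) <+> verts (apex ?L)"
      and eq: "case_sum (\<lambda>x. x) (\<lambda>x. x) x = case_sum (\<lambda>x. x) (\<lambda>x. x) y" for x y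
  proof -
    have refl: "(z, z) \<in> glue_rel ?K ?L" for z
      using equiv_glue_rel[of ?K ?L] by (meson UNIV_I equivE refl_onD)
    have gen: "(Inl c, Inr c) \<in> glue_rel ?K ?L" "(Inr c, Inl c) \<in> glue_rel ?K ?L" if "c \<in> C" for c
      using glue_rel_generator[of c ?K ?L] that equiv_glue_rel[of ?K ?L]
      by (auto dest: equivE elim: symE)
    \<comment> \<open>Elements of the sum with the same underlying vertex either agree or are the
      two copies of a vertex in both \<open>V\<close> and \<open>W\<close>.\<close>
    have "x = y \<or> (\<exists>c\<in>C. x = Inl c \<and> y = Inr c \<or> x = Inr c \<and> y = Inl c)"
      using xy eq unfolding C[symmetric] by auto
    then show ?thesis using refl gen by blast
  qed
  show "bij_betw (case_sum (\<lambda>x. x) (\<lambda>x. x)) (edges (apex ?K) <+> edges (apex ?L)) (edges (apex ?M))"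
    using EF by (force simp: bij_betw_def inj_on_def)
qed (auto simp: ugraph_hom_def)


section \<open>From monoidal decompositions to path decompositions\<close>

lemma path_decompositionI:
  assumes "1 \<le> n" "(\<Union>i<n. p i) = verts G"
    and "\<And>e. e \<in> edges G \<Longrightarrow> \<exists>i<n. ends G e \<subseteq> p i"
    and "\<And>i j k x. \<lbrakk>i \<le> j; j \<le> k; k < n; x \<in> p i; x \<in> p k\<rbrakk> \<Longrightarrow> x \<in> p j"
  shows "path_decomposition G n p"
  \<comment> \<open>The case \<open>k \<le> j \<le> i\<close> of the definition is the increasing
    one with \<open>i\<close> and \<open>k\<close> swapped, as intersection is symmetric.\<close>
  using assms unfolding path_decomposition_def by blast

lemma path_decomposition_interval:
  assumes "path_decomposition G n p" "i \<le> j" "j \<le> k" "k < n" "x \<in> p i" "x \<in> p k"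
  shows "x \<in> p j"
proof -
  have "i < n" "j < n" using assms by auto
  then have "p i \<inter> p k \<subseteq> p j" using assms(1-4) unfolding path_decomposition_def by blast
  then show ?thesis using assms(5,6) by blast
qed

lemma path_decomposition_bag_subset:
  "path_decomposition G n p \<Longrightarrow> i < n \<Longrightarrow> p i \<subseteq> verts G"
  unfolding path_decomposition_def by blast

lemma finite_bag: "ugraph G \<Longrightarrow> path_decomposition G n p \<Longrightarrow> i < n \<Longrightarrow> finite (p i)"
  using path_decomposition_bag_subset by (metis finite_subset ugraph_def)

lemma path_decomposition_iso:
  assumes G: "ugraph G" and iso: "ugraph_iso G H \<alpha>V \<alpha>E" and p: "path_decomposition G n p"
  shows "path_decomposition H n (\<lambda>i. \<alpha>V ` p i)"
proof (rule path_decompositionI)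
  have V: "bij_betw \<alpha>V (verts G) (verts H)" and E: "bij_betw \<alpha>E (edges G) (edges H)"
    and hom: "\<And>e. e \<in> edges G \<Longrightarrow> ends H (\<alpha>E e) = \<alpha>V ` ends G e"
    using iso by (auto simp: ugraph_iso_def ugraph_hom_def)
  show "1 \<le> n" using p by (simp add: path_decomposition_def)
  have "(\<Union>i<n. p i) = verts G" using p by (simp add: path_decomposition_def)
  then show "(\<Union>i<n. \<alpha>V ` p i) = verts H"
    using V by (simp add: image_UN[symmetric] bij_betw_def)
  show "\<exists>i<n. ends H f \<subseteq> \<alpha>V ` p i" if "f \<in> edges H" for f
  proof -
    have "f \<in> \<alpha>E ` edges G" using that by (simp add: bij_betw_imp_surj_on[OF E])
    then obtain e where e: "e \<in> edges G" "f = \<alpha>E e" by blast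
    then obtain i where "i < n" "ends G e \<subseteq> p i" using p by (auto simp: path_decomposition_def)
    then show ?thesis using e hom by (auto intro!: exI[of _ i])
  qed
  show "x \<in> \<alpha>V ` p j"
    if ijk: "i \<le> j" "j \<le> k" "k < n" and x: "x \<in> \<alpha>V ` p i" "x \<in> \<alpha>V ` p k" for i j k x
  proof -
    obtain v v' where v: "v \<in> p i" "v' \<in> p k" "x = \<alpha>V v" "x = \<alpha>V v'" using x by blast
    moreover have "v \<in> verts G" "v' \<in> verts G"
      using v ijk path_decomposition_bag_subset[OF p] by (meson le_less_trans subsetD)+
    \<comment> \<open>Bags consist of vertices, where \<alpha>V is injective; so \<open>x\<close>
      comes from a single vertex lying in both bags.\<close>
    ultimately have "v' = v" using V by (auto simp: bij_betw_def dest: inj_onD)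
    then show ?thesis using path_decomposition_interval[OF p ijk] v by blast
  qed
qed

text \<open>An upper bound \<open>w\<close> replaces the exact width so that both factors of a
  composition can share it. For empty source and target the conditions on the legs are
  vacuous.\<close>

definition linked_path_decomp :: "('a, 'v, 'e) pre_cospan \<Rightarrow> nat \<Rightarrow> nat \<Rightarrow> (nat \<Rightarrow> 'v set) \<Rightarrow> bool" where
  "linked_path_decomp K w n p \<longleftrightarrow> path_decomposition (apex K) n p \<and> (\<forall>i<n. card (p i) \<le> w) \<and>
     lleg K ` src K \<subseteq> p 0 \<and> rleg K ` tgt K \<subseteq> p (n - 1)"

lemma linked_path_decomp_iso:
  assumes K: "cospan K" and KL: "cospan_iso K L" and p: "linked_path_decomp K w n p"
  shows "\<exists>q. linked_path_decomp L w n q"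
proof -
  obtain \<alpha>V \<alpha>E where a: "ugraph_iso (apex K) (apex L) \<alpha>V \<alpha>E"
    "\<And>x. x \<in> src K \<Longrightarrow> \<alpha>V (lleg K x) = lleg L x"
    "\<And>x. x \<in> tgt K \<Longrightarrow> \<alpha>V (rleg K x) = rleg L x" "src K = src L" "tgt K = tgt L"
    using KL by (auto simp: cospan_iso_def)
  have G: "ugraph (apex K)" using K by (simp add: cospan_def)
  have p': "path_decomposition (apex K) n p" using p by (simp add: linked_path_decomp_def)
  have "card (\<alpha>V ` p i) \<le> w" if "i < n" for i
    using card_image_le[OF finite_bag[OF G p' that], of \<alpha>V] p that
    by (force simp: linked_path_decomp_def)
  then show ?thesis
    using p path_decomposition_iso[OF G a(1) p'] unfolding linked_path_decomp_def a(4,5)[symmetric]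
    by (intro exI[of _ "\<lambda>i. \<alpha>V ` p i"]) (auto simp: a(2,3)[symmetric])
qed

text \<open>A coarse description of the generated equivalence that suffices for concatenating
  decompositions: only interface vertices can be identified with something else.\<close>

lemma glue_rel_cases:
  assumes "(x, y) \<in> glue_rel K L"
  obtains "x = y"
  | "x \<in> Inl ` rleg K ` tgt K \<union> Inr ` lleg L ` tgt K" "y \<in> Inl ` rleg K ` tgt K \<union> Inr ` lleg L ` tgt K"
proof -
  let ?S = "Inl ` rleg K ` tgt K \<union> Inr ` lleg L ` tgt K"
  \<comment> \<open>The invariant collapses the interface to \<open>None\<close> and keeps all other
    elements apart; both members of a generating pair go to \<open>None\<close>.\<close>
  have "(if x \<in> ?S then None else Some x) = (if y \<in> ?S then None else Some y)"
    using assms by (rule glue_rel_invariant) auto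
  then show thesis using that by (auto split: if_splits)
qed

text \<open>
  Vertices identified by the gluing come from the interface, whose images lie in the last bag of
  one side and the first bag of the other: this is why consistency along the path survives even
  when the legs are not injective.
\<close>

lemma linked_path_decomp_glue:
  assumes K: "cospan K" and L: "cospan L" and KL: "tgt K = src L"
    and p: "linked_path_decomp K w m p" and q: "linked_path_decomp L w n q"
  shows "\<exists>r. linked_path_decomp (glue K L) w (m + n) r"
proof -
  have pd: "path_decomposition (apex K) m p" and qd: "path_decomposition (apex L) n q"
    using p q by (auto simp: linked_path_decomp_def)
  have pos: "1 \<le> m" "1 \<le> n" using pd qd by (auto simp: path_decomposition_def)
  have VK: "verts (apex K) = (\<Union>i<m. p i)" and VL: "verts (apex L) = (\<Union>i<n. q i)"
    using pd qd by (auto simp: path_decomposition_def)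
  have endK: "v \<in> p (m - 1)" if "Inl v \<in> Inl ` rleg K ` tgt K \<union> Inr ` lleg L ` tgt K" for v
    using that p by (auto simp: linked_path_decomp_def)
  have endL: "v \<in> q 0" if "Inr v \<in> Inl ` rleg K ` tgt K \<union> Inr ` lleg L ` tgt K" for v
    using that q KL by (auto simp: linked_path_decomp_def)
  \<comment> \<open>The two sequences of bags are concatenated, the second shifted by
    \<open>m\<close>; no bag is inserted for the interface.\<close>
  define r where "r i = (if i < m then glue_inl K L ` p i else glue_inr K L ` q (i - m))" for i
  have "path_decomposition (glue_graph K L) (m + n) r"
  proof (rule path_decompositionI)
    show "1 \<le> m + n" using pos by simp
    have "(\<Union>i<m+n. r i) = (\<Union>i<m. r i) \<union> (\<Union>i<n. r (m + i))"
    proof -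
      have "{..<m+n} = {..<m} \<union> (\<lambda>i. m + i) ` {..<n}"
        by (auto simp: image_iff) (metis add_diff_inverse_nat nat_add_left_cancel_less lessThan_iff)
      then show ?thesis by simp
    qed
    also have "\<dots> = glue_inl K L ` verts (apex K) \<union> glue_inr K L ` verts (apex L)"
      unfolding VK VL by (auto simp: r_def)
    also have "\<dots> = verts (glue_graph K L)"
      by (auto simp: glue_graph_def quotient_def)
    finally show "(\<Union>i<m+n. r i) = verts (glue_graph K L)" .
    show "\<exists>i<m+n. ends (glue_graph K L) e \<subseteq> r i" if e: "e \<in> edges (glue_graph K L)" for e
    proof (cases e)
      case (Inl a)
      then have "a \<in> edges (apex K)" using e by (auto simp: glue_graph_def)
      then obtain i where "i < m" "ends (apex K) a \<subseteq> p i"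
        using pd by (auto simp: path_decomposition_def)
      then show ?thesis using Inl by (intro exI[of _ i]) (auto simp: glue_graph_def r_def)
    next
      case (Inr b)
      then have "b \<in> edges (apex L)" using e by (auto simp: glue_graph_def)
      then obtain i where "i < n" "ends (apex L) b \<subseteq> q i"
        using qd by (auto simp: path_decomposition_def)
      then show ?thesis using Inr by (intro exI[of _ "m + i"]) (auto simp: glue_graph_def r_def)
    qed
    show "x \<in> r j" if ij: "i \<le> j" "j \<le> k" "k < m + n" and x: "x \<in> r i" "x \<in> r k" for i j k x
    \<comment> \<open>Three situations arise: both indices on the left, \<open>i\<close> left and
      \<open>k\<close> right, both on the right; \<open>i \<le> k\<close> excludes the
      fourth.\<close>
    proof (cases "k < m")
      case True
      then obtain v v' where v: "v \<in> p i" "v' \<in> p k" "x = glue_inl K L v" "x = glue_inl K L v'"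
        using x ij by (auto simp: r_def)
      then have "(Inl v, Inl v') \<in> glue_rel K L" by (metis glue_rel_class_eq_iff)
      then have "v \<in> p j"
      proof (cases rule: glue_rel_cases)
        case 1
        then show ?thesis using path_decomposition_interval[OF pd ij(1,2) True] v by simp
      next
        \<comment> \<open>An interface vertex lies in the last bag, so the interval property is
          applied between \<open>i\<close> and \<open>m - 1\<close>.\<close>
        case 2
        then show ?thesis
          using path_decomposition_interval[OF pd ij(1), of "m - 1"] True ij v(1) endK by force
      qed
      then show ?thesis using v True ij by (auto simp: r_def)
    next
      case False
      then obtain w' where w': "w' \<in> q (k - m)" "x = glue_inr K L w'"
        using x by (auto simp: r_def)
      show ?thesis
      proof (cases "i < m")
        case True
        then obtain v where v: "v \<in> p i" "x = glue_inl K L v" using x by (auto simp: r_def)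
        then have "(Inl v, Inr w') \<in> glue_rel K L" using w' by (metis glue_rel_class_eq_iff)
        then have e: "v \<in> p (m - 1)" "w' \<in> q 0"
        proof (atomize (full), cases rule: glue_rel_cases)
          \<comment> \<open>Contradictory: a left injection never equals a right one.\<close>
          case 1
          then show "v \<in> p (m - 1) \<and> w' \<in> q 0" by simp
        next
          case 2
          then show "v \<in> p (m - 1) \<and> w' \<in> q 0" using endK endL by blast
        qed
        show ?thesis
        proof (cases "j < m")
          case True
          then have "v \<in> p j"
            using path_decomposition_interval[OF pd ij(1), of "m - 1"] v e by auto
          then show ?thesis using v True by (auto simp: r_def)
        next
          case False
          then have "w' \<in> q (j - m)"
            using path_decomposition_interval[OF qd, of 0 "j - m" "k - m"] w' e ij by auto
          then show ?thesis using w' False by (auto simp: r_def)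
        qed
      next
        case i: False
        then obtain v where v: "v \<in> q (i - m)" "x = glue_inr K L v" using x by (auto simp: r_def)
        then have "(Inr v, Inr w') \<in> glue_rel K L" using w' by (metis glue_rel_class_eq_iff)
        then have "w' \<in> q (j - m)"
        proof (cases rule: glue_rel_cases)
          case 1
          then show ?thesis
            using path_decomposition_interval[OF qd, of "i - m" "j - m" "k - m"] w' v ij i by auto
        next
          case 2
          then show ?thesis
            using path_decomposition_interval[OF qd, of 0 "j - m" "k - m"] w' endL ij i by auto
        qed
        then show ?thesis using w' i ij by (auto simp: r_def)
      qed
    qed
  qed
  moreover have "card (r i) \<le> w" if "i < m + n" for i
  proof (cases "i < m")
    case True
    \<comment> \<open>Identifying vertices can only shrink a bag.\<close>
    then have "card (glue_inl K L ` p i) \<le> card (p i)"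
      using K pd by (intro card_image_le finite_bag) (auto simp: cospan_def)
    then show ?thesis using True p by (force simp: r_def linked_path_decomp_def)
  next
    case False
    then have i: "i - m < n" using that by simp
    then have "card (glue_inr K L ` q (i - m)) \<le> card (q (i - m))"
      using L qd by (intro card_image_le finite_bag) (auto simp: cospan_def)
    then show ?thesis using False q i by (force simp: r_def linked_path_decomp_def)
  qed
  moreover have "lleg (glue K L) ` src (glue K L) \<subseteq> r 0"
    using p pos by (auto simp: glue_def r_def linked_path_decomp_def)
  moreover have "rleg (glue K L) ` tgt (glue K L) \<subseteq> r (m + n - 1)"
    using q pos by (auto simp: glue_def r_def linked_path_decomp_def)
  ultimately show ?thesis unfolding linked_path_decomp_def by (auto simp: glue_def)
qed

lemma linked_path_decomp_mono:
  "linked_path_decomp K w n p \<Longrightarrow> w \<le> w' \<Longrightarrow> linked_path_decomp K w' n p"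
  unfolding linked_path_decomp_def by (meson le_trans)

text \<open>The induction ranges over all representatives \<open>M\<close>: a member of a composite
  arises from some \<open>K\<close> and \<open>L\<close> in the factors, and the induction
  hypotheses must apply to these. Concatenation handles their gluing, and isomorphism carries the
  result to \<open>M\<close>.\<close>

lemma monoidal_to_linked_path_decomp:
  assumes "monoidal_path_decomp f d" "M \<in> f"
  shows "\<exists>n p. linked_path_decomp M (decomp_width d) n p"
  using assms
proof (induction arbitrary: M rule: monoidal_path_decomp.induct)
  case (atom f)
  then obtain X Y where "f \<in> hom X Y" by (auto simp: atomic_def)
  note M = homD[OF this atom.prems]
  have "morphism_weight f = card (verts (apex M))"
    using morphism_weight_iso_class[OF M(1)] M(4) by simp
  \<comment> \<open>A single bag holding all vertices has exactly the weight of the atom, and both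
    legs land in it.\<close>
  then have "linked_path_decomp M (decomp_width (Atom f)) 1 (\<lambda>_. verts (apex M))"
    using M(1) by (auto simp: linked_path_decomp_def path_decomposition_def cospan_def ugraph_def)
  then show ?case by blast
next
  case (comp f1 A C f2 B d1 d2)
  then obtain K L where KL: "K \<in> f1" "L \<in> f2" and M: "M \<in> iso_class (glue K L)"
    by (auto simp: seq_compose_def)
  note K = homD[OF comp.hyps(1) KL(1)] and L = homD[OF comp.hyps(2) KL(2)]
  let ?w = "decomp_width (Comp d1 C d2)"
  obtain m p where "linked_path_decomp K (decomp_width d1) m p" using comp.IH(1) KL(1) by blast
  then have p: "linked_path_decomp K ?w m p" by (rule linked_path_decomp_mono) simp
  obtain n q where "linked_path_decomp L (decomp_width d2) n q" using comp.IH(2) KL(2) by blast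
  then have q: "linked_path_decomp L ?w n q" by (rule linked_path_decomp_mono) simp
  have eq: "tgt K = src L" using K L by simp
  obtain r where "linked_path_decomp (glue K L) ?w (m + n) r"
    using linked_path_decomp_glue[OF K(1) L(1) eq p q] by blast
  moreover have "cospan_iso (glue K L) M" using M by (simp add: iso_class_def)
  ultimately show ?case using linked_path_decomp_iso[OF cospan_glue[OF K(1) L(1) eq]] by blast
qed


section \<open>From path decompositions to monoidal decompositions\<close>

lemma iso_class_in_hom:
  fixes K :: "('u, 'u, 'u) pre_cospan"
  shows "cospan K \<Longrightarrow> src K = X \<Longrightarrow> tgt K = Y \<Longrightarrow> iso_class K \<in> hom X Y"
  unfolding hom_def by blast

text \<open>The part of \<open>G\<close> covered by the bags up to \<open>k\<close>; for a
  decomposition with \<open>n\<close> bags and \<open>k = n - 1\<close> it is all of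
  \<open>G\<close>.\<close>

definition prefix_graph :: "('v, 'e) pre_ugraph \<Rightarrow> (nat \<Rightarrow> 'v set) \<Rightarrow> nat \<Rightarrow> ('v, 'e) pre_ugraph" where
  "prefix_graph G p k = \<lparr>verts = (\<Union>i\<le>k. p i), edges = {e \<in> edges G. \<exists>i\<le>k. ends G e \<subseteq> p i}, ends = ends G\<rparr>"

text \<open>The compositions are nested to the left, one bag at a time. The right boundary
  \<open>Y\<close> stays arbitrary because the induction hypothesis is used with the interface to
  the next bag, \<open>p k \<inter> p (Suc k)\<close>.\<close>

lemma prefix_monoidal_path_decomp:
  fixes G :: "('u, 'u) pre_ugraph"
  assumes G: "ugraph G" and p: "path_decomposition G n p" and w: "\<And>i. i < n \<Longrightarrow> card (p i) \<le> w"
  shows "k < n \<Longrightarrow> Y \<subseteq> p k \<Longrightarrow>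
    \<exists>d. monoidal_path_decomp (iso_class (incl_cospan {} Y (prefix_graph G p k))) d \<and> decomp_width d \<le> w"
proof (induction k arbitrary: Y)
  case 0
  have "ugraph (prefix_graph G p 0)"
    using G finite_bag[OF G p] 0 by (auto simp: ugraph_def prefix_graph_def)
  then have c: "cospan (incl_cospan {} Y (prefix_graph G p 0))"
    using 0 by (intro cospan_incl_cospan) (auto simp: prefix_graph_def)
  let ?f = "iso_class (incl_cospan {} Y (prefix_graph G p 0)) :: 'u morphism"
  have "?f \<in> atomic" using iso_class_in_hom[OF c refl refl] by (auto simp: atomic_def)
  moreover have "morphism_weight ?f \<le> w"
    using morphism_weight_iso_class[OF c] w 0 by (simp add: prefix_graph_def)
  ultimately show ?case by (intro exI[of _ "Atom ?f"]) (auto intro: monoidal_path_decomp.atom)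
next
  case (Suc k)
  define C where "C = p k \<inter> p (Suc k)"
  define V where "V = (\<Union>i\<le>k. p i)"
  define E where "E = {e \<in> edges G. \<exists>i\<le>k. ends G e \<subseteq> p i}"
  \<comment> \<open>Edges already placed in the prefix are removed, since the gluing would otherwise
    duplicate them.\<close>
  define F where "F = {e \<in> edges G. ends G e \<subseteq> p (Suc k)} - E"
  \<comment> \<open>A vertex of the new bag that occurs in any earlier bag also lies in
    \<open>p k\<close>, by the interval property; hence the interface is the full intersection
    required by \<open>glue_incl_cospan\<close>.\<close>
  have CV: "V \<inter> p (Suc k) = C"
    using path_decomposition_interval[OF p _ _ Suc.prems(1), of _ k] by (auto simp: V_def C_def)
  have pre: "prefix_graph G p k = \<lparr>verts = V, edges = E, ends = ends G\<rparr>"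
    by (simp add: prefix_graph_def V_def E_def)
  have "E \<union> F = {e \<in> edges G. \<exists>i\<le>Suc k. ends G e \<subseteq> p i}"
    by (auto simp: E_def F_def le_Suc_eq)
  moreover have "V \<union> p (Suc k) = (\<Union>i\<le>Suc k. p i)" by (auto simp: V_def atMost_Suc)
  ultimately have preS: "prefix_graph G p (Suc k) =
      \<lparr>verts = V \<union> p (Suc k), edges = E \<union> F, ends = ends G\<rparr>"
    by (simp add: prefix_graph_def)
  have fin: "finite (p i)" if "i \<le> Suc k" for i
    using finite_bag[OF G p] that Suc.prems(1) by simp
  have uV: "ugraph \<lparr>verts = V, edges = E, ends = ends G\<rparr>"
    using G fin by (fastforce simp: ugraph_def V_def E_def)
  have uW: "ugraph \<lparr>verts = p (Suc k), edges = F, ends = ends G\<rparr>"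
    using G fin by (auto simp: ugraph_def F_def)
  let ?K = "incl_cospan {} C \<lparr>verts = V, edges = E, ends = ends G\<rparr>"
  let ?L = "incl_cospan C Y \<lparr>verts = p (Suc k), edges = F, ends = ends G\<rparr>"
  have cK: "cospan ?K" and cL: "cospan ?L"
    using uV uW CV Suc.prems(2) by (auto intro!: cospan_incl_cospan)
  have "cospan_iso (glue ?K ?L) (incl_cospan {} Y (prefix_graph G p (Suc k)))"
    unfolding preS using uV uW CV Suc.prems(2) by (intro glue_incl_cospan) (auto simp: F_def)
  then have "iso_class (glue ?K ?L) = iso_class (incl_cospan {} Y (prefix_graph G p (Suc k)))"
    by (intro iso_class_eqI cospan_glue cK cL) auto
  then have comp: "seq_compose (iso_class ?K) (iso_class ?L) =
      iso_class (incl_cospan {} Y (prefix_graph G p (Suc k)))"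
    using seq_compose_iso_class[OF cK cL] by simp
  obtain d where d: "monoidal_path_decomp (iso_class ?K) d" "decomp_width d \<le> w"
    using Suc.IH[of C] Suc.prems(1) by (auto simp: pre C_def)
  have hK: "iso_class ?K \<in> hom {} C" and hL: "iso_class ?L \<in> hom C Y"
    using cK cL by (auto intro!: iso_class_in_hom)
  have "monoidal_path_decomp (iso_class ?L) (Atom (iso_class ?L))"
    using hL by (intro monoidal_path_decomp.atom) (auto simp: atomic_def)
  with monoidal_path_decomp.comp[OF hK hL d(1)] have
    "monoidal_path_decomp (iso_class (incl_cospan {} Y (prefix_graph G p (Suc k))))
      (Comp d C (Atom (iso_class ?L)))"
    unfolding comp by blast
  \<comment> \<open>The interface is part of a bag, so its weight stays below the bound too.\<close>
  moreover have "card C \<le> card (p (Suc k))" unfolding C_def using fin by (intro card_mono) auto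
  then have "decomp_width (Comp d C (Atom (iso_class ?L))) \<le> w"
    using d(2) w[OF Suc.prems(1)] morphism_weight_iso_class[OF cL] by (simp add: object_weight_def)
  ultimately show ?case by blast
qed


section \<open>Comparison of the two widths\<close>

text \<open>The one-bag decomposition shows that the minimum is attained, so it can be traded for
  the existence of a decomposition within the bound.\<close>

lemma path_width_le_iff:
  assumes "ugraph G"
  shows "path_width G \<le> w \<longleftrightarrow> (\<exists>n p. path_decomposition G n p \<and> (\<forall>i<n. card (p i) \<le> w))"
proof -
  let ?P = "\<lambda>w. \<exists>n p. path_decomposition G n p \<and> w = path_decomposition_width n p"
  have le: "path_decomposition_width n p \<le> w \<longleftrightarrow> (\<forall>i<n. card (p i) \<le> w)"
    if "path_decomposition G n p" for n p w
  proof -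
    \<comment> \<open>The maximum over the bags is meaningful only because \<open>n\<close> is
      positive.\<close>
    have "0 \<in> {..<n}" using that by (simp add: path_decomposition_def)
    then have "{..<n} \<noteq> {}" by blast
    then show ?thesis by (auto simp: path_decomposition_width_def)
  qed
  have "path_decomposition G 1 (\<lambda>_. verts G)"
    using assms by (auto simp: path_decomposition_def ugraph_def)
  then have "?P (path_decomposition_width 1 (\<lambda>_. verts G))" by blast
  then have "?P (path_width G)" unfolding path_width_def by (rule LeastI)
  moreover have "path_width G \<le> path_decomposition_width n p" if "path_decomposition G n p" for n p
    unfolding path_width_def using that by (intro Least_le) blast
  ultimately show ?thesis using le by (metis order_refl order_trans)
qed

text \<open>Here the trivial decomposition \<open>Atom f\<close> guarantees that the minimum is
  attained.\<close>

lemma monoidal_path_width_le_iff: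
  assumes "f \<in> atomic"
  shows "monoidal_path_width f \<le> w \<longleftrightarrow> (\<exists>d. monoidal_path_decomp f d \<and> decomp_width d \<le> w)"
proof -
  let ?P = "\<lambda>w. \<exists>d. monoidal_path_decomp f d \<and> w = decomp_width d"
  have "?P (decomp_width (Atom f))" using monoidal_path_decomp.atom[OF assms] by blast
  then have "?P (monoidal_path_width f)" unfolding monoidal_path_width_def by (rule LeastI)
  moreover have "monoidal_path_width f \<le> decomp_width d" if "monoidal_path_decomp f d" for d
    unfolding monoidal_path_width_def using that by (intro Least_le) blast
  ultimately show ?thesis by (metis order_refl order_trans)
qed

section \<open>Copies of finite graphs over an infinite type\<close>

lemma finite_inj_into_infinite:
  assumes "finite A"
  obtains \<iota> :: "'a \<Rightarrow> 'u::infinite" where "inj_on \<iota> A"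
proof -
  obtain B :: "'u set" where B: "finite B" "card B = card A"
    using infinite_arbitrarily_large[OF infinite_UNIV] by blast
  then obtain \<iota> where "bij_betw \<iota> A B"
    using finite_same_card_bij[OF assms B(1)] by auto
  then show thesis by (intro that) (rule bij_betw_imp_inj_on)
qed

text \<open>Slicing a graph by inclusions uses subsets of its vertices as objects, so its vertices
  must come from \<open>'u\<close>; renaming along injections achieves this.\<close>

lemma ugraph_copy:
  fixes G :: "('v, 'e) pre_ugraph"
  assumes G: "ugraph G"
  obtains H :: "('u::infinite, 'u) pre_ugraph" and \<alpha>V \<alpha>E where "ugraph H" "ugraph_iso G H \<alpha>V \<alpha>E"
proof -
  have fin: "finite (verts G)" "finite (edges G)" using G by (auto simp: ugraph_def)
  obtain \<alpha>V :: "'v \<Rightarrow> 'u" where V: "inj_on \<alpha>V (verts G)"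
    using finite_inj_into_infinite[OF fin(1)] by blast
  obtain \<alpha>E :: "'e \<Rightarrow> 'u" where E: "inj_on \<alpha>E (edges G)"
    using finite_inj_into_infinite[OF fin(2)] by blast
  define H where "H = \<lparr>verts = \<alpha>V ` verts G, edges = \<alpha>E ` edges G,
    ends = \<lambda>f. \<alpha>V ` ends G (inv_into (edges G) \<alpha>E f)\<rparr>"
  have "card (\<alpha>V ` ends G e) = card (ends G e)" if "e \<in> edges G" for e
    using G V that by (intro card_image inj_on_subset[OF V]) (auto simp: ugraph_def)
  then have "ugraph H" using G E unfolding ugraph_def H_def by auto
  moreover have "ugraph_iso G H \<alpha>V \<alpha>E"
    using V E by (auto simp: ugraph_iso_def ugraph_hom_def H_def bij_betw_def)
  ultimately show thesis by (rule that)
qed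

theorem theorem45:
  fixes G :: "('v, 'e) pre_ugraph"
  assumes "ugraph G"
  shows "path_width G = monoidal_path_width (graph_morphism G :: 'u::infinite morphism)"
proof -
  let ?g = "graph_morphism G :: 'u morphism"
  let ?K = "\<lparr>src = {}, tgt = {}, apex = G, lleg = \<lambda>_. undefined, rleg = \<lambda>_. undefined\<rparr>
    :: ('u, 'v, 'e) pre_cospan"
  obtain H :: "('u, 'u) pre_ugraph" and \<alpha>V \<alpha>E where H: "ugraph H" and iso: "ugraph_iso G H \<alpha>V \<alpha>E"
    using ugraph_copy[OF assms] by blast
  let ?L = "incl_cospan {} {} H"
  have cK: "cospan ?K" using assms by (simp add: cospan_def)
  have cL: "cospan ?L" using H by (intro cospan_incl_cospan) auto
  have KL: "cospan_iso ?K ?L" using iso by (auto simp: cospan_iso_def)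
  have g: "?g = iso_class ?L" using iso_class_eqI[OF cK KL] by (simp add: graph_morphism_def)
  have gat: "?g \<in> atomic" using iso_class_in_hom[OF cL refl refl] by (auto simp: g atomic_def)
  \<comment> \<open>The two numbers are equal once they have the same upper bounds
    \<open>w\<close>.\<close>
  have "path_width G \<le> w \<longleftrightarrow> monoidal_path_width ?g \<le> w" for w
  proof
    assume "path_width G \<le> w"
    then obtain n p where p: "path_decomposition G n p" "\<And>i. i < n \<Longrightarrow> card (p i) \<le> w"
      using path_width_le_iff[OF assms] by blast
    define q where "q i = \<alpha>V ` p i" for i
    have q: "path_decomposition H n q"
      using path_decomposition_iso[OF assms iso p(1)] by (simp add: q_def[abs_def])
    have qw: "card (q i) \<le> w" if "i < n" for i
      using card_image_le[OF finite_bag[OF assms p(1) that], of \<alpha>V] p(2)[OF that]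
      by (simp add: q_def)
    \<comment> \<open>Since \<open>n\<close> is positive, the last prefix runs through all bags and
      is therefore the whole of \<open>H\<close>.\<close>
    have n: "n - 1 < n" "{..n - 1} = {..<n}" using q by (auto simp: path_decomposition_def)
    have "\<And>i. i < n \<longleftrightarrow> i \<le> n - 1" using n by auto
    then have "prefix_graph H q (n - 1) = H"
      using q n by (auto simp: prefix_graph_def path_decomposition_def intro!: pre_ugraph.equality)
    then show "monoidal_path_width ?g \<le> w"
      using prefix_monoidal_path_decomp[OF H q qw n(1), of "{}"] monoidal_path_width_le_iff[OF gat]
      by (simp add: g)
  next
    assume "monoidal_path_width ?g \<le> w"
    then obtain d where d: "monoidal_path_decomp ?g d" "decomp_width d \<le> w"
      using monoidal_path_width_le_iff[OF gat] by blast
    have "?L \<in> ?g" unfolding g by (rule iso_class_self[OF cL])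
    then obtain n p where "linked_path_decomp ?L (decomp_width d) n p"
      using monoidal_to_linked_path_decomp[OF d(1)] by blast
    \<comment> \<open>The bags live on the copy \<open>H\<close>; the inverse isomorphism brings
      them back to \<open>G\<close>.\<close>
    then obtain q where "linked_path_decomp ?K (decomp_width d) n q"
      using linked_path_decomp_iso[OF cL cospan_iso_sym[OF cK KL]] by blast
    then show "path_width G \<le> w"
      using d(2) path_width_le_iff[OF assms] by (fastforce simp: linked_path_decomp_def)
  qed
  then show ?thesis by (meson order_antisym order_refl)
qed

end
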